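(* Let $f\in L^1(\mathcal F_\infty)$ with $f\ge 0$ and let $\lambda>0$. Then one can write $$f=g+h+k$$ with $g,h,k\in L^1(\mathcal F_\infty)$ such that: (a) $$\mathbb P\Bigl(\sup_{n\ge1}|\mathbb E_n[g]|>0\Bigr)\le \frac{\|f\|_1}{\lambda},\qquad \|g\|_1\le 2\|f\|_1;$$ (b) $$\Bigl\|\sum_{n=1}^{\infty}\bigl|\mathbb E_n[h]-\mathbb E_{n-1}[h]\bigr|\Bigr\|_1\le 2\|f\|_1,$$ and in particular $\|h\|_1\le 2\|f\|_1$; (c) $$0\le k\le\lambda\ \text{ a.s.},\qquad \|k\|_1\le\|f\|_1,\qquad \|k\|_2^2\le\lambda\|f\|_1.$$
   Context: $(\Omega,\mathcal F,\mathbb P)$ is a complete probability space with a discrete filtration $(\mathcal F_n)_{n\ge1}$, and $\mathcal F_\infty:=\sigma\bigl(\bigcup_{n\ge1}\mathcal F_n\bigr)$. For a sub-$\sigma$-field $\mathcal F'\subseteq\mathcal F$, $L^p(\mathcal F')$ is the subspace of $L^p(\Omega,\mathbb P)$ consisting of $\mathcal F'$-measurable (real-valued) functions. $\mathbb E_n:=\mathbb E[\,\cdot\mid\mathcal F_n]$ for $n\ge1$, and $\mathbb E_0\equiv 0$ (the zero operator). $\|\cdot\|_p$ is the norm of $L^p(\Omega,\mathbb P)$. *)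

theory Defs
  imports "HOL-Probability.Probability"
begin

locale filtered_complete_prob_space = prob_space M + complete_measure M
  for M :: "'a measure" and F :: "nat \<Rightarrow> 'a measure" +
  assumes subalgebra_F: "\<And>n. 1 \<le> n \<Longrightarrow> subalgebra M (F n)"
    and sets_F_mono: "\<And>m n. 1 \<le> m \<Longrightarrow> m \<le> n \<Longrightarrow> sets (F m) \<subseteq> sets (F n)"

definition F_infty :: "'a measure \<Rightarrow> (nat \<Rightarrow> 'a measure) \<Rightarrow> 'a measure" where
  "F_infty M F = sigma (space M) (\<Union>n\<in>{1..}. sets (F n))"

definition ennreal_powr :: "ennreal \<Rightarrow> real \<Rightarrow> ennreal" where
  "ennreal_powr x p = (if x = \<infinity> then \<infinity> else ennreal (enn2real x powr p))"

text \<open>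
  The norms take values in \<open>[0,\<infinity>]\<close>, so a finite bound on a norm really asserts
  integrability; exponents are meant to be positive. The version for \<open>[0,\<infinity>]\<close>-valued
  functions is used for infinite series of nonnegative functions.
\<close>

definition Lp_norm_enn :: "'a measure \<Rightarrow> real \<Rightarrow> ('a \<Rightarrow> ennreal) \<Rightarrow> ennreal" where
  "Lp_norm_enn M p u = ennreal_powr (\<integral>\<^sup>+x. ennreal_powr (u x) p \<partial>M) (1 / p)"

definition Lp_norm :: "'a measure \<Rightarrow> real \<Rightarrow> ('a \<Rightarrow> real) \<Rightarrow> ennreal" where
  "Lp_norm M p f = Lp_norm_enn M p (\<lambda>x. ennreal \<bar>f x\<bar>)"

text \<open>
  Elements of \<open>L\<^sup>p\<close> are represented by functions, hence equalities and inequalities between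
  them are to be stated almost everywhere.
\<close>

definition Lp_sub :: "'a measure \<Rightarrow> real \<Rightarrow> 'a measure \<Rightarrow> ('a \<Rightarrow> real) set" where
  "Lp_sub M p F' = {f \<in> borel_measurable F'. Lp_norm M p f < \<infinity>}"

definition cond_E :: "'a measure \<Rightarrow> (nat \<Rightarrow> 'a measure) \<Rightarrow> nat \<Rightarrow> ('a \<Rightarrow> real) \<Rightarrow> 'a \<Rightarrow> real" where
  "cond_E M F n f = (if n = 0 then (\<lambda>x. 0) else real_cond_exp M (F n) f)"

lemma ennreal_powr_1 [simp]: "ennreal_powr x 1 = x"
  by (cases x) (auto simp: ennreal_powr_def)

lemma Lp_norm_enn_1: "Lp_norm_enn M 1 u = (\<integral>\<^sup>+x. u x \<partial>M)"
  by (simp add: Lp_norm_enn_def)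

lemma Lp_norm_1: "Lp_norm M 1 f = (\<integral>\<^sup>+x. ennreal \<bar>f x\<bar> \<partial>M)"
  by (simp add: Lp_norm_def Lp_norm_enn_1)

lemma Lp_sub_1_iff:
  assumes "subalgebra M F'"
  shows "f \<in> Lp_sub M 1 F' \<longleftrightarrow> f \<in> borel_measurable F' \<and> integrable M f"
proof -
  have "f \<in> borel_measurable F' \<Longrightarrow> f \<in> borel_measurable M"
    by (rule measurable_from_subalg[OF assms])
  then show ?thesis
    unfolding Lp_sub_def Lp_norm_1 integrable_iff_bounded mem_Collect_eq
    by (simp only: real_norm_def infinity_ennreal_def) blast
qed

lemma Lp_norm_2_sq: "(Lp_norm M 2 f)\<^sup>2 = (\<integral>\<^sup>+x. ennreal ((f x)\<^sup>2) \<partial>M)"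
proof -
  have "ennreal_powr (ennreal \<bar>f x\<bar>) 2 = ennreal ((f x)\<^sup>2)" for x
    by (simp add: ennreal_powr_def)
  moreover have "(ennreal_powr y (1 / 2))\<^sup>2 = y" for y
  proof (cases y)
    case (real r)
    then have "ennreal_powr y (1 / 2) = ennreal (sqrt r)"
      by (simp add: ennreal_powr_def powr_half_sqrt)
    with real show ?thesis
      by (simp add: ennreal_power)
  next
    case top
    then show ?thesis
      by (simp add: ennreal_powr_def power2_eq_square ennreal_top_mult)
  qed
  ultimately show ?thesis
    by (simp add: Lp_norm_def Lp_norm_enn_def)
qed

lemma (in filtered_complete_prob_space) subalgebra_F_infty: "subalgebra M (F_infty M F)"
proof -
  have "(\<Union>n\<in>{1..}. sets (F n)) \<subseteq> sets M"
    using subalgebra_F by (auto simp: subalgebra_def)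
  moreover from this have "(\<Union>n\<in>{1..}. sets (F n)) \<subseteq> Pow (space M)"
    using sets.space_closed by blast
  ultimately show ?thesis
    unfolding subalgebra_def F_infty_def
    by (simp add: sets.sigma_sets_subset)
qed

end

theory Submission
  imports Defs
begin

text \<open>
  Let $f_n = E_n f$. We build a martingale $k_n$ with values in $[0,\lambda]$, starting from
  $k_1 = \min(f_1,\lambda)$ and stopped at the first time $T$ at which it reaches $\lambda$. Before $T$,
  set $y = k_n + f_{n+1} - f_n$ and
  \[ k_{n+1} = \lambda - \theta\,(\lambda - y)^+, \qquad
     \theta = \frac{\lambda - k_n}{E_n[(\lambda - y)^+]} \in (0,1], \]
  so that $E_n k_{n+1} = k_n$. The corrections $y - k_{n+1}$ are the increments of a martingale $h_n$
  with $h_1 = 0$. They are nonpositive as long as $k_{n+1} < \lambda$, where $k_n = f_n - h_n \ge -h_n$;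
  so the negative variation of $h$ up to time $n$ is at most $k_n$, and since the increments
  have mean zero the total variation has mean at most $2 E k_n \le 2 E f$. With $h = \lim h_n$, put
  $k = f - h$ on $\{T = \infty\}$, $k = \lambda$ elsewhere, and $g = f - h - k$. Then $E_n k = k_n$, which
  gives $0 \le k \le \lambda$; $E_n g$ vanishes before $T$, and $\lambda P(T < \infty) \le E k \le E f$.
  Finally $h + k \ge 0$ yields $\|g\|_1 \le E f + E(h + k) \le 2 E f$.
\<close>

section \<open>Approximation of sets and limits of conditional expectations\<close>

text \<open>Sets approximable from the algebra form a sigma-field: complements leave the symmetric
  difference unchanged, and a countable union is first cut to finitely many members, which are then
  approximated one by one.\<close>

lemma (in finite_measure) sigma_sets_approx_algebra:
  assumes A: "algebra (space M) A" "A \<subseteq> sets M"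
    and B: "B \<in> sigma_sets (space M) A" and e: "0 < e"
  shows "\<exists>C\<in>A. measure M (sym_diff B C) < e"
proof -
  interpret A: algebra "space M" A by fact
  have sub: "sigma_sets (space M) A \<subseteq> sets M"
    using A(2) by (rule sets.sigma_sets_subset)
  show ?thesis using B e
  proof (induction arbitrary: e)
    case (Basic a)
    then show ?case by (intro bexI[of _ a]) auto
  next
    case Empty
    then show ?case by (intro bexI[of _ "{}"]) auto
  next
    case (Compl a)
    then obtain C where C: "C \<in> A" "measure M (sym_diff a C) < e" by blast
    have "a \<subseteq> space M" "C \<subseteq> space M"
      using Compl(1) C(1) sub sets.sets_into_space A(2) by blast+
    then have "sym_diff (space M - a) (space M - C) = sym_diff a C" by blast
    with C show ?case by (intro bexI[of _ "space M - C"]) auto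
  next
    case (Union a)
    have a: "a i \<in> sets M" for i using Union(1) sub by blast
    let ?U = "\<lambda>N. \<Union>i<N. a i"
    have "(\<lambda>N. measure M (?U N)) \<longlonglongrightarrow> measure M (\<Union>N. ?U N)"
      using a by (intro finite_Lim_measure_incseq) (force simp: incseq_def)+
    moreover have "(\<Union>N. ?U N) = (\<Union>i. a i)" by auto
    ultimately have "(\<lambda>N. measure M (?U N)) \<longlonglongrightarrow> measure M (\<Union>i. a i)" by simp
    then have "\<forall>\<^sub>F N in sequentially. measure M (\<Union>i. a i) - e / 2 < measure M (?U N)"
      using Union.prems by (intro order_tendstoD) auto
    then obtain N where N: "measure M (\<Union>i. a i) - e / 2 < measure M (?U N)"
      by (auto simp: eventually_sequentially)
    \<comment> \<open>The N errors sum to at most e / 2; the summand 1 keeps the denominator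
      positive when N = 0.\<close>
    define d where "d = e / (2 * (real N + 1))"
    have "d > 0" using Union.prems by (simp add: d_def)
    then have "\<forall>i. \<exists>C\<in>A. measure M (sym_diff (a i) C) < d" using Union.IH by blast
    then obtain C where C: "\<And>i. C i \<in> A" "\<And>i. measure M (sym_diff (a i) (C i)) < d"
      by metis
    have Cm: "C i \<in> sets M" for i using C A(2) by blast
    let ?V = "\<Union>i<N. C i"
    have "sym_diff (\<Union>i. a i) ?V \<subseteq> ((\<Union>i. a i) - ?U N) \<union> (\<Union>i<N. sym_diff (a i) (C i))"
      by auto
    then have "measure M (sym_diff (\<Union>i. a i) ?V)
        \<le> measure M (((\<Union>i. a i) - ?U N) \<union> (\<Union>i<N. sym_diff (a i) (C i)))"
      using a Cm by (intro finite_measure_mono) auto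
    also have "\<dots> \<le> measure M ((\<Union>i. a i) - ?U N) + measure M (\<Union>i<N. sym_diff (a i) (C i))"
      using a Cm by (intro measure_Un_le) auto
    also have "measure M ((\<Union>i. a i) - ?U N) = measure M (\<Union>i. a i) - measure M (?U N)"
      using a by (intro finite_measure_Diff) auto
    also have "measure M (\<Union>i<N. sym_diff (a i) (C i)) \<le> (\<Sum>i<N. measure M (sym_diff (a i) (C i)))"
      using a Cm by (intro finite_measure_subadditive_finite) auto
    also have "\<dots> \<le> (\<Sum>i<N. d)" using C(2) by (intro sum_mono less_imp_le)
    also have "\<dots> \<le> e / 2" using Union.prems by (simp add: d_def field_simps)
    finally have "measure M (sym_diff (\<Union>i. a i) ?V) < e" using N by linarith
    moreover have "?V \<in> A" using C(1) by auto
    ultimately show ?case by blast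
  qed
qed

text \<open>Over any set of \<open>F\<close> the integrals of \<open>s j\<close> equal that of
  \<open>v\<close> for all \<open>j \<ge> N\<close> and converge to that of \<open>u\<close> by
  dominated convergence. This identifies the limit of a martingale as the variable that closes
  it.\<close>

lemma (in sigma_finite_subalgebra) real_cond_exp_dominated_limit:
  fixes s :: "nat \<Rightarrow> 'a \<Rightarrow> real"
  assumes [measurable]: "\<And>j. s j \<in> borel_measurable M" "u \<in> borel_measurable M"
    and w: "integrable M w"
    and lim: "AE x in M. (\<lambda>j. s j x) \<longlonglongrightarrow> u x"
    and bound: "\<And>j. AE x in M. \<bar>s j x\<bar> \<le> w x"
    and v: "v \<in> borel_measurable F"
    and eq: "\<And>j. N \<le> j \<Longrightarrow> AE x in M. real_cond_exp M F (s j) x = v x"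
  shows "AE x in M. real_cond_exp M F u x = v x"
proof (rule real_cond_exp_charact)
  have s: "integrable M (s j)" for j
    by (rule integrable_dominated_convergence2[OF _ _ w lim]) (use bound in auto)
  show u: "integrable M u"
    by (rule integrable_dominated_convergence[OF _ _ w lim]) (use bound in auto)
  have vM[measurable]: "v \<in> borel_measurable M" by (rule measurable_from_subalg[OF subalg v])
  \<comment> \<open>\<open>v\<close> agrees a.e. with the conditional expectation of
    \<open>s N\<close>.\<close>
  show "integrable M v"
    using integrable_cong_AE[OF _ _ eq[OF order_refl]] real_cond_exp_int(1)[OF s[of N]] by auto
  show "v \<in> borel_measurable F" by fact
  fix A assume A: "A \<in> sets F"
  then have [measurable]: "A \<in> sets M" using subalg by (auto simp: subalgebra_def)
  have "(\<lambda>j. \<integral>x\<in>A. s j x \<partial>M) \<longlonglongrightarrow> (\<integral>x\<in>A. u x \<partial>M)"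
    unfolding set_lebesgue_integral_def
  proof (rule integral_dominated_convergence[where w = w])
    show "AE x in M. (\<lambda>j. indicator A x *\<^sub>R s j x) \<longlonglongrightarrow> indicator A x *\<^sub>R u x"
      using lim by eventually_elim (intro tendsto_intros)
    show "AE x in M. norm (indicator A x *\<^sub>R s j x) \<le> w x" for j
      using bound[of j] by eventually_elim (auto simp: indicator_def)
  qed (use w in auto)
  moreover have "\<forall>\<^sub>F j in sequentially. (\<integral>x\<in>A. s j x \<partial>M) = (\<integral>x\<in>A. v x \<partial>M)"
  proof (rule eventually_sequentiallyI)
    fix j assume "N \<le> j"
    have "(\<integral>x\<in>A. s j x \<partial>M) = (\<integral>x\<in>A. real_cond_exp M F (s j) x \<partial>M)"
      by (rule real_cond_exp_intA[OF s A])
    also have "\<dots> = (\<integral>x\<in>A. v x \<partial>M)"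
      unfolding set_lebesgue_integral_def
      by (rule integral_cong_AE) (use eq[OF \<open>N \<le> j\<close>] in auto)
    finally show "(\<integral>x\<in>A. s j x \<partial>M) = (\<integral>x\<in>A. v x \<partial>M)" .
  qed
  ultimately show "(\<integral>x\<in>A. u x \<partial>M) = (\<integral>x\<in>A. v x \<partial>M)"
    using tendsto_unique[OF _ _ tendsto_eventually] by (metis trivial_limit_sequentially)
qed

section \<open>The filtration, and signs read off conditional expectations\<close>

context filtered_complete_prob_space
begin

lemma sigma_finite_subalgebra_F: "sigma_finite_subalgebra M (F (Suc n))"
  by (intro finite_measure_subalgebra_is_sigma_finite finite_measure_subalgebra.intro
      finite_measure_subalgebra_axioms.intro subalgebra_F finite_measure_axioms) simp

lemma subalgebra_F_mono: "m \<le> n \<Longrightarrow> subalgebra (F (Suc n)) (F (Suc m))"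
  using subalgebra_F[of "Suc m"] subalgebra_F[of "Suc n"] sets_F_mono[of "Suc m" "Suc n"]
  by (auto simp: subalgebra_def)

lemma subalgebra_F_infty_F: "subalgebra (F_infty M F) (F (Suc n))"
proof -
  have "sets (F i) \<subseteq> sets M" if "1 \<le> i" for i
    using subalgebra_F[OF that] by (auto simp: subalgebra_def)
  then have "(\<Union>i\<in>{1..}. sets (F i)) \<subseteq> Pow (space M)"
    using sets.space_closed by fastforce
  then show ?thesis using subalgebra_F[of "Suc n"]
    by (auto simp: subalgebra_def F_infty_def intro!: sigma_sets.Basic)
qed

text \<open>Two members lie in a common \<open>F (Suc n)\<close> because the filtration increases;
  countably many need not, so only an algebra is claimed.\<close>

lemma algebra_Union_F: "algebra (space M) (\<Union>n. sets (F (Suc n)))"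
  unfolding algebra_iff_Un
proof (intro conjI ballI)
  have sp: "space (F (Suc n)) = space M" for n
    using subalgebra_F[of "Suc n"] by (auto simp: subalgebra_def)
  show "(\<Union>n. sets (F (Suc n))) \<subseteq> Pow (space M)"
    using sets.space_closed[of "F (Suc _)"] sp by (auto dest: sets.sets_into_space)
  show "{} \<in> (\<Union>n. sets (F (Suc n)))" by auto
  show "space M - a \<in> (\<Union>n. sets (F (Suc n)))" if "a \<in> (\<Union>n. sets (F (Suc n)))" for a
    using that sp sets.compl_sets by fastforce
  show "a \<union> b \<in> (\<Union>n. sets (F (Suc n)))"
    if "a \<in> (\<Union>n. sets (F (Suc n)))" "b \<in> (\<Union>n. sets (F (Suc n)))" for a b
  proof -
    from that obtain m n where "a \<in> sets (F (Suc m))" "b \<in> sets (F (Suc n))" by auto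
    then have "a \<in> sets (F (Suc (max m n)))" "b \<in> sets (F (Suc (max m n)))"
      using sets_F_mono[of "Suc m" "Suc (max m n)"] sets_F_mono[of "Suc n" "Suc (max m n)"]
      by auto
    then show ?thesis by blast
  qed
qed

text \<open>The integrals of \<open>u\<close> over sets of any \<open>F (Suc n)\<close> are
  nonnegative. Approximating the set where \<open>u\<close> is negative by such sets makes the
  integral over it nonnegative too, so it is null. This transfers the bounds 0 and
  \<open>lam\<close> from the martingale to \<open>k_lim\<close>.\<close>

lemma F_infty_nonneg_AE:
  assumes u: "u \<in> borel_measurable (F_infty M F)" "integrable M u"
    and pos: "\<And>n. AE x in M. 0 \<le> real_cond_exp M (F (Suc n)) u x"
  shows "AE x in M. 0 \<le> u x"
proof -
  have um[measurable]: "u \<in> borel_measurable M" using u by auto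
  let ?A = "\<Union>n. sets (F (Suc n))"
  have FM: "sets (F (Suc n)) \<subseteq> sets M" for n
    using subalgebra_F[of "Suc n"] by (auto simp: subalgebra_def)
  have AM: "?A \<subseteq> sets M" using FM by auto
  have posA: "0 \<le> (\<integral>x\<in>C. u x \<partial>M)" if "C \<in> ?A" for C
  proof -
    from that obtain n where C: "C \<in> sets (F (Suc n))" by auto
    interpret n: sigma_finite_subalgebra M "F (Suc n)" by (rule sigma_finite_subalgebra_F)
    have "(\<integral>x\<in>C. u x \<partial>M) = (\<integral>x\<in>C. real_cond_exp M (F (Suc n)) u x \<partial>M)"
      by (rule n.real_cond_exp_intA[OF u(2) C])
    also have "\<dots> \<ge> 0"
      unfolding set_lebesgue_integral_def
      by (rule integral_nonneg_AE) (use pos[of n] in \<open>auto elim!: eventually_mono\<close>)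
    finally show ?thesis .
  qed
  \<comment> \<open>Approximating in the measure with density \<open>\<bar>u x\<bar>\<close> turns a
    small symmetric difference directly into a small change of the integral of
    \<open>u\<close>.\<close>
  define N where "N = density M (\<lambda>x. ennreal \<bar>u x\<bar>)"
  interpret N: finite_measure N
    by (rule finite_measureI)
      (use u(2) in \<open>simp add: N_def emeasure_density integrable_iff_bounded cong: nn_integral_cong\<close>)
  have Nm: "measure N S = (\<integral>x\<in>S. \<bar>u x\<bar> \<partial>M)" if [measurable]: "S \<in> sets M" for S
  proof -
    have "integrable M (\<lambda>x. indicator S x *\<^sub>R \<bar>u x\<bar>)"
      using u(2) that by (intro integrable_mult_indicator) auto
    moreover have "emeasure N S = (\<integral>\<^sup>+x. ennreal (indicator S x *\<^sub>R \<bar>u x\<bar>) \<partial>M)"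
      by (auto simp: N_def emeasure_density intro!: nn_integral_cong split: split_indicator)
    ultimately show ?thesis
      by (intro measure_eq_emeasure_eq_ennreal)
        (auto simp: set_lebesgue_integral_def nn_integral_eq_integral intro!: integral_nonneg_AE)
  qed
  define B where "B = {x \<in> space M. u x < 0}"
  have "space (F_infty M F) = space M"
    using subalgebra_F_infty by (simp add: subalgebra_def)
  then have B: "B \<in> sets (F_infty M F)"
    using borel_measurable_less[OF u(1), of "\<lambda>_. 0"] by (simp add: B_def)
  have [measurable]: "B \<in> sets M" by (simp add: B_def)
  have "(\<Union>n\<in>{1..}. sets (F n)) = ?A"
    by (force simp: atLeast_def Suc_le_eq gr0_conv_Suc)
  moreover have "?A \<subseteq> Pow (space M)" using AM sets.space_closed by blast
  ultimately have B': "B \<in> sigma_sets (space N) ?A"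
    using B by (simp add: F_infty_def N_def)
  have ge: "- e \<le> (\<integral>x\<in>B. u x \<partial>M)" if "0 < e" for e
  proof -
    have "algebra (space N) ?A" "?A \<subseteq> sets N"
      using algebra_Union_F AM by (simp_all add: N_def)
    from N.sigma_sets_approx_algebra[OF this B' that]
    obtain C where C: "C \<in> ?A" "measure N (sym_diff B C) < e" by blast
    have [measurable]: "C \<in> sets M" using C AM by blast
    have int: "integrable M (\<lambda>x. indicator S x * u x)" "integrable M (\<lambda>x. indicator S x * \<bar>u x\<bar>)"
      if "S \<in> sets M" for S
      using integrable_mult_indicator[OF that u(2)]
        integrable_mult_indicator[OF that integrable_abs[OF u(2)]] by simp_all
    \<comment> \<open>Pointwise, replacing \<open>C\<close> by \<open>B\<close> loses at most
      \<open>\<bar>u x\<bar>\<close>, and only on the symmetric difference.\<close>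
    have "(\<integral>x\<in>C. u x \<partial>M) - (\<integral>x\<in>sym_diff B C. \<bar>u x\<bar> \<partial>M)
        = (\<integral>x. indicator C x * u x - indicator (sym_diff B C) x * \<bar>u x\<bar> \<partial>M)"
      unfolding set_lebesgue_integral_def by (subst Bochner_Integration.integral_diff) (simp_all add: int)
    also have "\<dots> \<le> (\<integral>x\<in>B. u x \<partial>M)"
      unfolding set_lebesgue_integral_def real_scaleR_def
      by (rule integral_mono)
        (auto intro!: int Bochner_Integration.integrable_diff split: split_indicator)
    finally show ?thesis using posA[OF C(1)] C(2) Nm[of "sym_diff B C"] by auto
  qed
  have "0 \<le> (\<integral>x\<in>B. u x \<partial>M)"
    by (rule field_le_epsilon) (use ge in \<open>force simp: field_simps\<close>)
  then have "(\<integral>x. indicator B x *\<^sub>R (- u x) \<partial>M) \<le> 0"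
    by (simp add: set_lebesgue_integral_def)
  moreover have nn: "AE x in M. 0 \<le> indicator B x *\<^sub>R (- u x)"
    by (auto simp: B_def split: split_indicator)
  moreover have i: "integrable M (\<lambda>x. indicator B x *\<^sub>R (- u x))"
    using u(2) by (intro integrable_mult_indicator) auto
  ultimately have "AE x in M. indicator B x *\<^sub>R (- u x) = 0"
    using integral_nonneg_eq_0_iff_AE[OF i nn] integral_nonneg_AE[OF nn] by linarith
  then show ?thesis
    using AE_space by eventually_elim (auto simp: B_def indicator_def not_less split: if_splits)
qed

end

section \<open>One rescaled step, and martingales over several steps\<close>

text \<open>Here \<open>l\<close> is the current gap and \<open>d\<close> the next increment of the
  given martingale. The set where \<open>l\<close> is positive lies in \<open>F\<close>, so
  \<open>v\<close> has conditional mean \<open>l\<close>; clipping at 0 raises it to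
  \<open>q \<ge> l\<close>, and the \<open>F\<close>-measurable factor \<open>l / q\<close> brings
  it back.\<close>

lemma (in sigma_finite_subalgebra) real_cond_exp_rescaled_step:
  fixes l d :: "'a \<Rightarrow> real"
  assumes lF[measurable]: "l \<in> borel_measurable F" and l: "integrable M l"
    and l0: "AE x in M. 0 \<le> l x"
    and d: "integrable M d" and Ed: "AE x in M. real_cond_exp M F d x = 0"
  defines "v \<equiv> \<lambda>x. if 0 < l x then l x - d x else 0"
  defines "q \<equiv> real_cond_exp M F (\<lambda>x. max 0 (v x))"
  shows "integrable M v"
    and "AE x in M. real_cond_exp M F v x = l x"
    and "AE x in M. l x \<le> q x"
    and "integrable M (\<lambda>x. l x * max 0 (v x) / q x)"
    and "AE x in M. real_cond_exp M F (\<lambda>x. l x * max 0 (v x) / q x) x = l x"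
proof -
  have lM[measurable]: "l \<in> borel_measurable M" using l by auto
  have [measurable]: "d \<in> borel_measurable M" using d by auto
  have vm[measurable]: "v \<in> borel_measurable M" unfolding v_def by measurable
  let ?a = "\<lambda>x. indicator {0::real<..} (l x) :: real"
  have v_eq: "v = (\<lambda>x. ?a x * (l x - d x))"
    by (auto simp: v_def fun_eq_iff indicator_def)
  have ld: "integrable M (\<lambda>x. l x - d x)" using l d by auto
  show v: "integrable M v"
    by (rule Bochner_Integration.integrable_bound[OF ld]) (auto simp: v_def)
  have "AE x in M. real_cond_exp M F v x = ?a x * real_cond_exp M F (\<lambda>x. l x - d x) x"
    unfolding v_eq by (rule real_cond_exp_mult) (use v in \<open>auto simp: v_eq\<close>)
  then show Ev: "AE x in M. real_cond_exp M F v x = l x"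
    using real_cond_exp_diff[OF l d] real_cond_exp_F_meas[OF l lF] Ed l0
    by eventually_elim (auto simp: indicator_def)
  have p: "integrable M (\<lambda>x. max 0 (v x))" using v by auto
  have "AE x in M. real_cond_exp M F v x \<le> q x"
    unfolding q_def by (rule real_cond_exp_mono) (use v p in auto)
  with Ev show lq: "AE x in M. l x \<le> q x" by eventually_elim simp
  have [measurable]: "q \<in> borel_measurable F" unfolding q_def by simp
  have [measurable]: "q \<in> borel_measurable M" unfolding q_def by simp
  \<comment> \<open>The factor \<open>l / q\<close> is at most 1, and a vanishing \<open>q\<close>
    gives the value 0.\<close>
  have le: "AE x in M. norm (l x * max 0 (v x) / q x) \<le> norm (max 0 (v x))"
    using lq l0
  proof eventually_elim
    fix x assume "l x \<le> q x" "0 \<le> l x"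
    then show "norm (l x * max 0 (v x) / q x) \<le> norm (max 0 (v x))"
      using mult_right_mono[of "l x" "q x" "max 0 (v x)"]
      by (cases "q x = 0") (auto simp: divide_simps mult.commute abs_mult)
  qed
  show i: "integrable M (\<lambda>x. l x * max 0 (v x) / q x)"
    by (rule Bochner_Integration.integrable_bound[OF p _ le]) measurable
  then have i': "integrable M (\<lambda>x. (l x / q x) * max 0 (v x))" by simp
  have "AE x in M. real_cond_exp M F (\<lambda>x. (l x / q x) * max 0 (v x)) x = (l x / q x) * q x"
    unfolding q_def by (rule real_cond_exp_mult) (use i' in \<open>auto simp: q_def\<close>)
  \<comment> \<open>Where \<open>q\<close> vanishes so does \<open>l\<close>, so the product is
    still \<open>l\<close>.\<close>
  then show "AE x in M. real_cond_exp M F (\<lambda>x. l x * max 0 (v x) / q x) x = l x"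
    using lq l0 by eventually_elim auto
qed

context filtered_complete_prob_space
begin

lemma martingale_cond_exp:
  assumes m: "\<And>n. integrable M (m n)" "m n \<in> borel_measurable (F (Suc n))"
    and step: "\<And>n. AE x in M. real_cond_exp M (F (Suc n)) (m (Suc n)) x = m n x"
    and "n \<le> j"
  shows "AE x in M. real_cond_exp M (F (Suc n)) (m j) x = m n x"
  using \<open>n \<le> j\<close>
proof (induction j rule: dec_induct)
  interpret n: sigma_finite_subalgebra M "F (Suc n)" by (rule sigma_finite_subalgebra_F)
  case base
  show ?case using m by auto
next
  interpret n: sigma_finite_subalgebra M "F (Suc n)" by (rule sigma_finite_subalgebra_F)
  case (step j)
  have "AE x in M. real_cond_exp M (F (Suc n)) (real_cond_exp M (F (Suc j)) (m (Suc j))) x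
      = real_cond_exp M (F (Suc n)) (m (Suc j)) x"
    using step.hyps by (intro n.real_cond_exp_nested_subalg subalgebra_F subalgebra_F_mono m) auto
  moreover have "AE x in M. real_cond_exp M (F (Suc n)) (real_cond_exp M (F (Suc j)) (m (Suc j))) x
      = real_cond_exp M (F (Suc n)) (m j) x"
    using m by (intro n.real_cond_exp_cong assms(3)) auto
  ultimately show ?case using step.IH by eventually_elim simp
qed

end

section \<open>The processes of the decomposition\<close>

locale gundy_decomposition = filtered_complete_prob_space +
  fixes f :: "'a \<Rightarrow> real" and lam :: real
  assumes f_meas: "f \<in> borel_measurable (F_infty M F)"
    and f_int: "integrable M f"
    and f_nonneg: "AE x in M. 0 \<le> f x"
    and lam_pos: "0 < lam"
begin

text \<open>Indices are shifted by one: \<open>X n\<close>, \<open>gap n\<close>, \<open>h n\<close> are measurable for \<open>F (Suc n)\<close>.\<close>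

definition X :: "nat \<Rightarrow> 'a \<Rightarrow> real" where
  "X n = real_cond_exp M (F (Suc n)) f"

text \<open>The gap enters as a parameter because \<open>gap\<close> is defined by recursion through
  \<open>trial\<close>. The increment of \<open>X\<close> is subtracted since gaps are measured down
  from \<open>lam\<close>.\<close>

definition trial :: "nat \<Rightarrow> ('a \<Rightarrow> real) \<Rightarrow> 'a \<Rightarrow> real" where
  "trial n l x = (if 0 < l x then l x - (X (Suc n) x - X n x) else 0)"

text \<open>
  \<open>lam - gap n\<close> is the martingale $k_{n+1}$, and the process is absorbed once \<open>gap n\<close> is \<open>0\<close>.
  Before that, \<open>lam - trial n (gap n)\<close> is what $k_{n+2}$ would be if it followed the increments
  of $f$; clipping it at \<open>lam\<close> only increases the mean of the gap, so the clipped gap is multiplied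
  by an $F_{n+1}$-measurable factor at most \<open>1\<close> to restore the martingale property. The factor
  \<open>0 / 0\<close> occurs only where \<open>gap n\<close> is \<open>0\<close>, up to a null set.
\<close>

primrec gap :: "nat \<Rightarrow> 'a \<Rightarrow> real" where
  "gap 0 = (\<lambda>x. max 0 (lam - X 0 x))"
| "gap (Suc n) = (\<lambda>x. gap n x * max 0 (trial n (gap n) x) /
      real_cond_exp M (F (Suc n)) (\<lambda>y. max 0 (trial n (gap n) y)) x)"

text \<open>The denominator in the recursion for \<open>gap\<close>; the factor \<theta> is
  \<open>gap n x / scale n x\<close>.\<close>

definition scale :: "nat \<Rightarrow> 'a \<Rightarrow> real" where
  "scale n = real_cond_exp M (F (Suc n)) (\<lambda>y. max 0 (trial n (gap n) y))"

text \<open>While the process is alive this is the correction y - k, because both terms are measured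
  down from \<open>lam\<close>.\<close>

definition incr :: "nat \<Rightarrow> 'a \<Rightarrow> real" where
  "incr n x = gap (Suc n) x - trial n (gap n) x"

definition h :: "nat \<Rightarrow> 'a \<Rightarrow> real" where
  "h n x = (\<Sum>i<n. incr i x)"

definition neg :: "nat \<Rightarrow> 'a \<Rightarrow> real" where
  "neg n x = (\<Sum>i<n. max 0 (- incr i x))"

lemma gap_Suc: "gap (Suc n) x = gap n x * max 0 (trial n (gap n) x) / scale n x"
  by (simp add: scale_def)

declare gap.simps(2) [simp del]

section \<open>Measurability, integrability and the martingale property\<close>

lemma lift_F: "u \<in> borel_measurable (F (Suc m)) \<Longrightarrow> m \<le> n \<Longrightarrow> u \<in> borel_measurable (F (Suc n))"
  using measurable_from_subalg[OF subalgebra_F_mono] .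

lemma X_meas: "m \<le> n \<Longrightarrow> X m \<in> borel_measurable (F (Suc n))"
  unfolding X_def by (rule lift_F) auto

lemma X_int: "integrable M (X n)" and integral_X: "integral\<^sup>L M (X n) = integral\<^sup>L M f"
proof -
  interpret n: sigma_finite_subalgebra M "F (Suc n)" by (rule sigma_finite_subalgebra_F)
  show "integrable M (X n)" "integral\<^sup>L M (X n) = integral\<^sup>L M f"
    unfolding X_def using n.real_cond_exp_int[OF f_int] .
qed

lemma cond_exp_X_diff: "AE x in M. real_cond_exp M (F (Suc n)) (\<lambda>x. X (Suc n) x - X n x) x = 0"
proof -
  interpret n: sigma_finite_subalgebra M "F (Suc n)" by (rule sigma_finite_subalgebra_F)
  have "AE x in M. real_cond_exp M (F (Suc n)) (X (Suc n)) x = X n x"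
    unfolding X_def by (intro n.real_cond_exp_nested_subalg subalgebra_F subalgebra_F_mono f_int) auto
  moreover have "AE x in M. real_cond_exp M (F (Suc n)) (X n) x = X n x"
    by (intro n.real_cond_exp_F_meas X_int X_meas) simp
  ultimately show ?thesis
    using n.real_cond_exp_diff[OF X_int X_int, of "Suc n" n] by eventually_elim simp
qed

text \<open>The three properties go through one induction, since the rescaled step needs all of them
  for the current gap.\<close>

lemma gap_meas_int_nonneg:
  "gap n \<in> borel_measurable (F (Suc n)) \<and> integrable M (gap n) \<and> (AE x in M. 0 \<le> gap n x)"
proof (induction n)
  case 0
  have [measurable]: "X 0 \<in> borel_measurable (F (Suc 0))" by (rule X_meas) simp
  have "(\<lambda>x. max 0 (lam - X 0 x)) \<in> borel_measurable (F (Suc 0))" by measurable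
  moreover have "integrable M (\<lambda>x. max 0 (lam - X 0 x))" using X_int by auto
  ultimately show ?case by simp
next
  case (Suc n)
  interpret n: sigma_finite_subalgebra M "F (Suc n)" by (rule sigma_finite_subalgebra_F)
  have [measurable]: "X (Suc n) \<in> borel_measurable (F (Suc (Suc n)))"
    "X n \<in> borel_measurable (F (Suc (Suc n)))" by (auto intro: X_meas)
  have [measurable]: "gap n \<in> borel_measurable (F (Suc (Suc n)))"
    using Suc by (auto intro: lift_F)
  have [measurable]: "scale n \<in> borel_measurable (F (Suc (Suc n)))"
    unfolding scale_def by (rule lift_F[of _ n]) auto
  have d: "integrable M (\<lambda>x. X (Suc n) x - X n x)" using X_int by auto
  \<comment> \<open>With \<open>gap n\<close> for \<open>l\<close> and the increment of
    \<open>X\<close> for \<open>d\<close>, the functions \<open>v\<close> and \<open>q\<close> are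
    exactly \<open>trial n (gap n)\<close> and \<open>scale n\<close>.\<close>
  note step = n.real_cond_exp_rescaled_step[OF _ _ _ d cond_exp_X_diff, of "gap n",
      folded trial_def, folded scale_def, folded gap_Suc]
  have "integrable M (gap (Suc n))" using step(4) Suc by auto
  moreover have "AE x in M. gap n x \<le> scale n x" using step(3) Suc by blast
  then have "AE x in M. 0 \<le> gap (Suc n) x"
    using Suc[THEN conjunct2, THEN conjunct2] unfolding gap_Suc
    by eventually_elim auto
  moreover have "(\<lambda>x. gap n x * max 0 (trial n (gap n) x) / scale n x)
      \<in> borel_measurable (F (Suc (Suc n)))"
    unfolding trial_def by measurable
  then have "gap (Suc n) \<in> borel_measurable (F (Suc (Suc n)))"
    by (simp add: gap.simps(2) scale_def)
  ultimately show ?case by blast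
qed

lemma gap_meas: "m \<le> n \<Longrightarrow> gap m \<in> borel_measurable (F (Suc n))"
  using gap_meas_int_nonneg lift_F by blast

lemma gap_int: "integrable M (gap n)"
  using gap_meas_int_nonneg by blast

lemma trial_int: "integrable M (trial n (gap n))"
  and cond_exp_trial: "AE x in M. real_cond_exp M (F (Suc n)) (trial n (gap n)) x = gap n x"
  and gap_le_scale: "AE x in M. gap n x \<le> scale n x"
  and cond_exp_gap: "AE x in M. real_cond_exp M (F (Suc n)) (gap (Suc n)) x = gap n x"
proof -
  interpret n: sigma_finite_subalgebra M "F (Suc n)" by (rule sigma_finite_subalgebra_F)
  have d: "integrable M (\<lambda>x. X (Suc n) x - X n x)" using X_int by auto
  note step = n.real_cond_exp_rescaled_step[OF _ _ _ d cond_exp_X_diff, of "gap n",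
      folded trial_def, folded scale_def, folded gap_Suc]
  show "integrable M (trial n (gap n))"
    "AE x in M. real_cond_exp M (F (Suc n)) (trial n (gap n)) x = gap n x"
    "AE x in M. gap n x \<le> scale n x"
    "AE x in M. real_cond_exp M (F (Suc n)) (gap (Suc n)) x = gap n x"
    using step[OF conjunct1[OF gap_meas_int_nonneg] gap_int] gap_meas_int_nonneg by blast+
qed

lemma incr_meas: "i < n \<Longrightarrow> incr i \<in> borel_measurable (F (Suc n))"
proof -
  assume "i < n"
  have [measurable]: "X (Suc i) \<in> borel_measurable (F (Suc n))"
    "X i \<in> borel_measurable (F (Suc n))" "gap i \<in> borel_measurable (F (Suc n))"
    "gap (Suc i) \<in> borel_measurable (F (Suc n))"
    using \<open>i < n\<close> by (auto intro!: X_meas gap_meas)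
  show ?thesis unfolding incr_def[abs_def] trial_def by measurable
qed

lemma incr_int: "integrable M (incr n)"
  unfolding incr_def[abs_def] by (intro Bochner_Integration.integrable_diff gap_int trial_int)

text \<open>The rescaling is made for this: \<open>gap (Suc n)\<close> and
  \<open>trial n (gap n)\<close> share the conditional mean \<open>gap n\<close>.\<close>

lemma cond_exp_incr: "AE x in M. real_cond_exp M (F (Suc n)) (incr n) x = 0"
proof -
  interpret n: sigma_finite_subalgebra M "F (Suc n)" by (rule sigma_finite_subalgebra_F)
  show ?thesis
    using n.real_cond_exp_diff[OF gap_int[of "Suc n"] trial_int[of n]] cond_exp_trial[of n]
      cond_exp_gap[of n]
    unfolding incr_def[abs_def] by eventually_elim simp
qed

lemma integral_incr: "integral\<^sup>L M (incr n) = 0"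
proof -
  interpret n: sigma_finite_subalgebra M "F (Suc n)" by (rule sigma_finite_subalgebra_F)
  have "integral\<^sup>L M (incr n) = integral\<^sup>L M (real_cond_exp M (F (Suc n)) (incr n))"
    using n.real_cond_exp_int(2)[OF incr_int] by simp
  also have "\<dots> = (\<integral>x. 0 \<partial>M)"
    by (rule integral_cong_AE) (use cond_exp_incr in auto)
  finally show ?thesis by simp
qed

lemma h_meas: "h n \<in> borel_measurable (F (Suc n))"
  unfolding h_def[abs_def] by (intro borel_measurable_sum incr_meas) auto

lemma h_int: "integrable M (h n)"
  unfolding h_def[abs_def] by (intro Bochner_Integration.integrable_sum incr_int)

lemma cond_exp_h_Suc: "AE x in M. real_cond_exp M (F (Suc n)) (h (Suc n)) x = h n x"
proof -
  interpret n: sigma_finite_subalgebra M "F (Suc n)" by (rule sigma_finite_subalgebra_F)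
  have eq: "h (Suc n) = (\<lambda>x. h n x + incr n x)" by (simp add: h_def fun_eq_iff)
  show ?thesis unfolding eq
    using n.real_cond_exp_add[OF h_int incr_int, of n n] cond_exp_incr[of n]
      n.real_cond_exp_F_meas[OF h_int h_meas]
    by eventually_elim simp
qed

lemma cond_exp_h: "n \<le> j \<Longrightarrow> AE x in M. real_cond_exp M (F (Suc n)) (h j) x = h n x"
  by (rule martingale_cond_exp[where m = h]) (auto intro: h_int h_meas cond_exp_h_Suc)

lemma cond_exp_gap': "n \<le> j \<Longrightarrow> AE x in M. real_cond_exp M (F (Suc n)) (gap j) x = gap n x"
  by (rule martingale_cond_exp[where m = gap]) (use gap_int gap_meas cond_exp_gap in auto)

section \<open>Pathwise analysis: absorption and negative variation\<close>

text \<open>Collects countably many a.e. inequalities, so that the estimates can be argued path by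
  path.\<close>

definition regular :: "'a \<Rightarrow> bool" where
  "regular x \<longleftrightarrow> (\<forall>n. 0 \<le> X n x \<and> gap n x \<le> scale n x)"

lemma AE_regular: "AE x in M. regular x"
proof -
  have "AE x in M. 0 \<le> X n x" for n
  proof -
    interpret n: sigma_finite_subalgebra M "F (Suc n)" by (rule sigma_finite_subalgebra_F)
    show ?thesis unfolding X_def by (rule n.real_cond_exp_pos) (use f_nonneg f_int in auto)
  qed
  then show ?thesis using gap_le_scale by (simp add: regular_def AE_all_countable)
qed

lemma gap_nonneg: "regular x \<Longrightarrow> 0 \<le> gap n x"
proof (induction n)
  case (Suc n)
  then have "0 \<le> gap n x" "gap n x \<le> scale n x" by (auto simp: regular_def)
  then show ?case by (simp add: gap_Suc)
qed simp

text \<open>Absorption: \<open>trial\<close> takes its default value 0 there, and the next gap has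
  the factor \<open>max 0 0\<close>.\<close>

lemma gap_dead: "gap n x \<le> 0 \<Longrightarrow> gap (Suc n) x = 0 \<and> incr n x = 0"
  by (auto simp: trial_def incr_def gap_Suc)

text \<open>By \<open>gap_dead\<close> a positive gap was positive at all earlier indices. Along
  such a path every step adds the increment of \<open>X\<close> minus \<open>incr\<close>, starting
  from \<open>lam - gap 0 x = X 0 x\<close>.\<close>

lemma gap_alive: "0 < gap n x \<Longrightarrow> lam - gap n x = X n x - h n x"
proof (induction n)
  case 0
  then show ?case by (simp add: h_def)
next
  case (Suc n)
  then have "0 < gap n x" using gap_dead[of n x] by force
  with Suc show ?case by (simp add: h_def incr_def trial_def)
qed

text \<open>
  While the process is alive, \<open>h\<close> only decreases; it can increase only at the absorption time.
  Hence its negative variation is dominated by the bounded martingale \<open>lam - gap n\<close>.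
\<close>

lemma neg_bound:
  assumes "regular x"
  shows "neg n x \<le> lam - gap n x \<and> (0 < gap n x \<longrightarrow> neg n x = - h n x)"
proof (induction n)
  case 0
  then show ?case using assms lam_pos by (auto simp: neg_def h_def regular_def)
next
  case (Suc n)
  have neg: "neg (Suc n) x = neg n x + max 0 (- incr n x)" by (simp add: neg_def)
  have h: "h (Suc n) x = h n x + incr n x" by (simp add: h_def)
  show ?case
  proof (cases "gap n x \<le> 0")
    case True
    then show ?thesis using Suc gap_dead[OF True] gap_nonneg[OF assms, of n] neg
      by (simp)
  next
    case False
    define t where "t = trial n (gap n) x"
    have scale: "gap n x \<le> scale n x" using assms by (simp add: regular_def)
    have g: "gap (Suc n) x = gap n x * max 0 t / scale n x"
      using gap_Suc by (simp add: t_def)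
    have i: "incr n x = gap (Suc n) x - t" by (simp add: incr_def t_def)
    show ?thesis
    proof (cases "t \<le> 0")
      case True
      \<comment> \<open>Absorption at this step: the correction is \<open>- t \<ge> 0\<close>, so
        \<open>neg\<close> does not grow while its bound rises to \<open>lam\<close>.\<close>
      then have "gap (Suc n) x = 0" using g by simp
      with True i neg Suc False show ?thesis by (simp)
    next
      case pos: False
      have "0 < scale n x" using scale False by linarith
      then have gpos: "0 < gap (Suc n) x" and le: "gap (Suc n) x \<le> t"
        using pos False mult_right_mono[OF scale, of t]
        by (auto simp: g pos_divide_le_eq mult.commute)
      \<comment> \<open>The correction is nonpositive, so \<open>neg\<close> grows exactly as
        \<open>h\<close> falls; dropping \<open>X (Suc n) x \<ge> 0\<close> from the identity for
        live paths then gives the bound.\<close>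
      then have "neg (Suc n) x = - h (Suc n) x"
        using neg i h Suc False by simp
      moreover have "lam - gap (Suc n) x = X (Suc n) x - h (Suc n) x"
        by (rule gap_alive[OF gpos])
      moreover have "0 \<le> X (Suc n) x" using assms by (simp add: regular_def)
      ultimately show ?thesis by linarith
    qed
  qed
qed

section \<open>Mean bounds for the total variation of the corrections\<close>

lemma integral_gap: "integral\<^sup>L M (gap n) = integral\<^sup>L M (gap 0)"
proof -
  interpret n: sigma_finite_subalgebra M "F (Suc 0)" by (rule sigma_finite_subalgebra_F)
  have "integral\<^sup>L M (gap n) = integral\<^sup>L M (real_cond_exp M (F (Suc 0)) (gap n))"
    using n.real_cond_exp_int(2)[OF gap_int] by simp
  also have "\<dots> = integral\<^sup>L M (gap 0)"
    by (rule integral_cong_AE) (use cond_exp_gap'[of 0 n] gap_int[of 0] in auto)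
  finally show ?thesis .
qed

text \<open>The mean is constant in n, and at index 0 the integrand is the minimum of
  \<open>X 0 x\<close> and \<open>lam\<close>.\<close>

lemma integral_lam_gap_le: "(\<integral>x. lam - gap n x \<partial>M) \<le> integral\<^sup>L M f"
proof -
  have "(\<integral>x. lam - gap n x \<partial>M) = (\<integral>x. lam - gap 0 x \<partial>M)"
    using integral_gap[of n] gap_int by (simp add: prob_space del: gap.simps)
  also have "\<dots> \<le> integral\<^sup>L M (X 0)"
    using X_int[of 0] by (intro integral_mono) auto
  finally show ?thesis by (simp add: integral_X)
qed

text \<open>A correction has mean zero, so its absolute mean is twice the mean of its negative part;
  the negative parts add up to \<open>neg n\<close>.\<close>

lemma integral_abs_incr_sum_le: "(\<Sum>i<n. \<integral>x. \<bar>incr i x\<bar> \<partial>M) \<le> 2 * integral\<^sup>L M f"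
proof -
  have "(\<integral>x. \<bar>incr i x\<bar> \<partial>M) = 2 * (\<integral>x. max 0 (- incr i x) \<partial>M)" for i
  proof -
    have "(\<integral>x. \<bar>incr i x\<bar> \<partial>M) = (\<integral>x. incr i x + 2 * max 0 (- incr i x) \<partial>M)"
      by (rule Bochner_Integration.integral_cong) auto
    also have "\<dots> = integral\<^sup>L M (incr i) + (\<integral>x. 2 * max 0 (- incr i x) \<partial>M)"
      by (rule Bochner_Integration.integral_add) (use incr_int[of i] in auto)
    finally show ?thesis by (simp add: integral_incr)
  qed
  then have "(\<Sum>i<n. \<integral>x. \<bar>incr i x\<bar> \<partial>M) = 2 * (\<integral>x. neg n x \<partial>M)"
    unfolding neg_def using incr_int
    by (subst Bochner_Integration.integral_sum) (auto simp: sum_distrib_left)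
  also have "(\<integral>x. neg n x \<partial>M) \<le> (\<integral>x. lam - gap n x \<partial>M)"
  proof (rule integral_mono_AE)
    show "integrable M (neg n)" unfolding neg_def[abs_def] using incr_int by auto
    show "AE x in M. neg n x \<le> lam - gap n x"
      using AE_regular by eventually_elim (use neg_bound in auto)
  qed (use gap_int in auto)
  finally show ?thesis using integral_lam_gap_le[of n] by linarith
qed

lemma summable_integral_abs_incr: "summable (\<lambda>i. \<integral>x. \<bar>incr i x\<bar> \<partial>M)"
  using integral_abs_incr_sum_le by (intro summableI_nonneg_bounded) auto

lemma AE_summable_incr: "AE x in M. summable (\<lambda>i. \<bar>incr i x\<bar>)"
proof -
  have [measurable]: "incr i \<in> borel_measurable M" for i using incr_int by auto
  have "(\<integral>\<^sup>+x. (\<Sum>i. ennreal \<bar>incr i x\<bar>) \<partial>M) = (\<Sum>i. \<integral>\<^sup>+x. ennreal \<bar>incr i x\<bar> \<partial>M)"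
    by (rule nn_integral_suminf) measurable
  also have "\<dots> = (\<Sum>i. ennreal (\<integral>x. \<bar>incr i x\<bar> \<partial>M))"
    using incr_int by (simp add: nn_integral_eq_integral)
  also have "\<dots> \<noteq> \<infinity>"
    unfolding infinity_ennreal_def
    by (rule ennreal_suminf_neq_top[OF summable_integral_abs_incr]) simp
  finally have "AE x in M. (\<Sum>i. ennreal \<bar>incr i x\<bar>) \<noteq> \<infinity>"
    by (intro nn_integral_PInf_AE) auto
  then show ?thesis
    by eventually_elim (auto intro: summable_suminf_not_top)
qed

section \<open>The limits and their conditional expectations\<close>

definition h_lim :: "'a \<Rightarrow> real" where
  "h_lim x = (\<Sum>i. incr i x)"

definition k_lim :: "'a \<Rightarrow> real" where
  "k_lim x = (if \<forall>n. 0 < gap n x then f x - h_lim x else lam)"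

text \<open>Serves as the integrable majorant of all \<open>h n\<close>.\<close>

definition variation :: "'a \<Rightarrow> real" where
  "variation x = (\<Sum>i. \<bar>incr i x\<bar>)"

lemma variation_int: "integrable M variation"
  unfolding variation_def[abs_def]
  by (rule integrable_suminf) (use incr_int AE_summable_incr summable_integral_abs_incr in auto)

lemma h_le_variation: "summable (\<lambda>i. \<bar>incr i x\<bar>) \<Longrightarrow> \<bar>h n x\<bar> \<le> variation x"
  unfolding h_def variation_def
  by (rule order_trans[OF sum_abs]) (auto intro: sum_le_suminf)

lemma h_tendsto: "summable (\<lambda>i. \<bar>incr i x\<bar>) \<Longrightarrow> (\<lambda>n. h n x) \<longlonglongrightarrow> h_lim x"
  unfolding h_def h_lim_def by (rule summable_LIMSEQ) (rule summable_rabs_cancel)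

lemma h_lim_meas: "h_lim \<in> borel_measurable (F_infty M F)"
  unfolding h_lim_def[abs_def]
  using measurable_from_subalg[OF subalgebra_F_infty_F incr_meas[OF lessI]]
  by (intro borel_measurable_suminf)

lemma k_lim_meas: "k_lim \<in> borel_measurable (F_infty M F)"
proof -
  have [measurable]: "gap n \<in> borel_measurable (F_infty M F)" for n
    using measurable_from_subalg[OF subalgebra_F_infty_F gap_meas[OF order_refl]] .
  note [measurable] = h_lim_meas f_meas
  show ?thesis unfolding k_lim_def[abs_def] by measurable
qed

lemma h_lim_meas_M [measurable]: "h_lim \<in> borel_measurable M"
  using measurable_from_subalg[OF subalgebra_F_infty h_lim_meas] .

lemma k_lim_meas_M [measurable]: "k_lim \<in> borel_measurable M"
  using measurable_from_subalg[OF subalgebra_F_infty k_lim_meas] .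

lemma h_lim_int: "integrable M h_lim"
  and cond_exp_h_lim: "AE x in M. real_cond_exp M (F (Suc n)) h_lim x = h n x"
proof -
  interpret n: sigma_finite_subalgebra M "F (Suc n)" by (rule sigma_finite_subalgebra_F)
  have lim: "AE x in M. (\<lambda>n. h n x) \<longlonglongrightarrow> h_lim x"
    using AE_summable_incr by eventually_elim (rule h_tendsto)
  have bound: "AE x in M. \<bar>h j x\<bar> \<le> variation x" for j
    using AE_summable_incr by eventually_elim (rule h_le_variation)
  show "integrable M h_lim"
    by (rule integrable_dominated_convergence[OF _ _ variation_int lim])
      (use bound h_int in auto)
  show "AE x in M. real_cond_exp M (F (Suc n)) h_lim x = h n x"
    by (rule n.real_cond_exp_dominated_limit[OF _ _ variation_int lim bound h_meas cond_exp_h])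
      (use h_int in auto)
qed

lemma k_lim_int: "integrable M k_lim"
  and cond_exp_k_lim: "AE x in M. real_cond_exp M (F (Suc n)) k_lim x = lam - gap n x"
proof -
  \<comment> \<open>No almost sure convergence of $E_n f$ is needed: replacing $E_n f$ by $f$ on the alive event
    does not change the conditional expectation, and these variables converge trivially.\<close>
  define w where "w j x = (if 0 < gap j x then f x - h j x else lam)" for j x
  define b where "b x = lam + \<bar>f x\<bar> + variation x" for x
  have [measurable]: "gap j \<in> borel_measurable M" "h j \<in> borel_measurable M"
    "f \<in> borel_measurable M" for j
    using gap_int h_int f_int by auto
  have [measurable]: "w j \<in> borel_measurable M" for j unfolding w_def[abs_def] by measurable
  have b: "integrable M b" unfolding b_def[abs_def] using f_int variation_int by auto
  have bound: "AE x in M. \<bar>w j x\<bar> \<le> b x" for j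
    using AE_summable_incr
  proof eventually_elim
    fix x assume "summable (\<lambda>i. \<bar>incr i x\<bar>)"
    then show "\<bar>w j x\<bar> \<le> b x"
      using h_le_variation[of x j] lam_pos by (auto simp: w_def b_def)
  qed
  have lim: "AE x in M. (\<lambda>j. w j x) \<longlonglongrightarrow> k_lim x"
    using AE_summable_incr
  proof eventually_elim
    fix x assume s: "summable (\<lambda>i. \<bar>incr i x\<bar>)"
    show "(\<lambda>j. w j x) \<longlonglongrightarrow> k_lim x"
    proof (cases "\<forall>n. 0 < gap n x")
      case True
      then show ?thesis
        using h_tendsto[OF s] by (auto simp: w_def k_lim_def intro!: tendsto_intros)
    next
      case False
      then obtain N where N: "gap N x \<le> 0" by (auto simp: not_less)
      \<comment> \<open>Absorption is permanent, so \<open>w j x\<close> is eventually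
        \<open>lam\<close>.\<close>
      have "gap j x \<le> 0" if "N \<le> j" for j
        using that by (induction rule: dec_induct) (use N gap_dead[of _ x] in auto)
      then have "\<forall>\<^sub>F j in sequentially. w j x = lam"
        by (intro eventually_sequentiallyI[of N]) (force simp: w_def)
      moreover have "k_lim x = lam" unfolding k_lim_def by (rule if_not_P[OF False])
      ultimately have "\<forall>\<^sub>F j in sequentially. w j x = k_lim x" by simp
      then show ?thesis by (rule tendsto_eventually)
    qed
  qed
  show "integrable M k_lim"
    by (rule integrable_dominated_convergence[OF _ _ b lim]) (use bound in auto)
  have w_int: "integrable M (w j)" for j
    by (rule Bochner_Integration.integrable_bound[OF b]) (use bound[of j] in \<open>auto elim!: eventually_mono\<close>)
  \<comment> \<open>The alive event lies in \<open>F (Suc j)\<close>. On it the conditional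
    expectation is \<open>X j x - h j x\<close>, which is \<open>lam - gap j x\<close>; off it the
    gap is 0 and the value is \<open>lam\<close>.\<close>
  have Ew: "AE x in M. real_cond_exp M (F (Suc j)) (w j) x = lam - gap j x" for j
  proof -
    interpret j: sigma_finite_subalgebra M "F (Suc j)" by (rule sigma_finite_subalgebra_F)
    let ?a = "\<lambda>x. indicator {0::real<..} (gap j x) :: real"
    have [measurable]: "gap j \<in> borel_measurable (F (Suc j))" by (rule gap_meas) simp
    have fh: "integrable M (\<lambda>x. f x - h j x)" using f_int h_int by auto
    then have afh: "integrable M (\<lambda>x. ?a x * (f x - h j x))"
      by (rule Bochner_Integration.integrable_bound) (auto simp: indicator_def)
    have na: "integrable M (\<lambda>x. (1 - ?a x) * lam)"
      by (rule integrable_const_bound[where B = lam]) (use lam_pos in \<open>auto simp: indicator_def\<close>)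
    have "(\<lambda>x. (1 - ?a x) * lam) \<in> borel_measurable (F (Suc j))" by measurable
    note j.real_cond_exp_F_meas[OF na this]
    moreover have "AE x in M. real_cond_exp M (F (Suc j)) (\<lambda>x. ?a x * (f x - h j x)) x
        = ?a x * real_cond_exp M (F (Suc j)) (\<lambda>x. f x - h j x) x"
      by (rule j.real_cond_exp_mult) (use afh in auto)
    moreover note j.real_cond_exp_diff[OF f_int h_int[of j]] j.real_cond_exp_F_meas[OF h_int h_meas]
      j.real_cond_exp_add[OF afh na] AE_regular
    ultimately have "AE x in M. real_cond_exp M (F (Suc j))
        (\<lambda>x. ?a x * (f x - h j x) + (1 - ?a x) * lam) x = lam - gap j x"
    proof eventually_elim
      case (elim x)
      then show ?case
        using gap_alive[of j x] gap_nonneg[of x j]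
        by (cases "0 < gap j x") (auto simp: X_def)
    qed
    moreover have "w j = (\<lambda>x. ?a x * (f x - h j x) + (1 - ?a x) * lam)"
      by (auto simp: w_def fun_eq_iff indicator_def)
    ultimately show ?thesis by simp
  qed
  interpret n: sigma_finite_subalgebra M "F (Suc n)" by (rule sigma_finite_subalgebra_F)
  show "AE x in M. real_cond_exp M (F (Suc n)) k_lim x = lam - gap n x"
  proof (rule n.real_cond_exp_dominated_limit[OF _ _ b lim bound])
    have [measurable]: "gap n \<in> borel_measurable (F (Suc n))" by (rule gap_meas) simp
    show "(\<lambda>x. lam - gap n x) \<in> borel_measurable (F (Suc n))" by measurable
    fix j assume "n \<le> j"
    \<comment> \<open>By the tower property \<open>w j\<close> may be replaced by
      \<open>lam - gap j\<close>, whose conditional expectation no longer depends on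
      \<open>j\<close>.\<close>
    have "AE x in M. real_cond_exp M (F (Suc n)) (real_cond_exp M (F (Suc j)) (w j)) x
        = real_cond_exp M (F (Suc n)) (w j) x"
      using \<open>n \<le> j\<close> by (intro n.real_cond_exp_nested_subalg subalgebra_F subalgebra_F_mono w_int) auto
    moreover have "AE x in M. real_cond_exp M (F (Suc n)) (real_cond_exp M (F (Suc j)) (w j)) x
        = real_cond_exp M (F (Suc n)) (\<lambda>x. lam - gap j x) x"
      by (intro n.real_cond_exp_cong Ew) auto
    moreover have c: "integrable M (\<lambda>x. lam)" by simp
    have "AE x in M. real_cond_exp M (F (Suc n)) (\<lambda>x. lam) x = lam" using c by auto
    moreover note n.real_cond_exp_diff[OF c gap_int[of j]] cond_exp_gap'[OF \<open>n \<le> j\<close>]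
    ultimately show "AE x in M. real_cond_exp M (F (Suc n)) (w j) x = lam - gap n x"
      by eventually_elim simp
  qed auto
qed

section \<open>Bounds for the three summands\<close>

text \<open>The conditional expectations \<open>lam - gap n x\<close> dominate the nonnegative
  \<open>neg n x\<close>.\<close>

lemma k_lim_nonneg: "AE x in M. 0 \<le> k_lim x"
proof (rule F_infty_nonneg_AE[OF k_lim_meas k_lim_int])
  fix n
  show "AE x in M. 0 \<le> real_cond_exp M (F (Suc n)) k_lim x"
    using cond_exp_k_lim[of n] AE_regular
  proof eventually_elim
    case (elim x)
    have "0 \<le> neg n x" by (auto simp: neg_def intro!: sum_nonneg)
    with elim neg_bound[OF elim(2), of n] show ?case by simp
  qed
qed

lemma k_lim_le: "AE x in M. k_lim x \<le> lam"
proof -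
  have c: "integrable M (\<lambda>x. lam)" by simp
  note [measurable] = k_lim_meas
  have "AE x in M. 0 \<le> lam - k_lim x"
  proof (rule F_infty_nonneg_AE)
    fix n
    interpret n: sigma_finite_subalgebra M "F (Suc n)" by (rule sigma_finite_subalgebra_F)
    have "AE x in M. real_cond_exp M (F (Suc n)) (\<lambda>x. lam) x = lam" using c by auto
    then show "AE x in M. 0 \<le> real_cond_exp M (F (Suc n)) (\<lambda>x. lam - k_lim x) x"
      using n.real_cond_exp_diff[OF c k_lim_int] cond_exp_k_lim[of n] AE_regular
      by eventually_elim (use gap_nonneg in auto)
  qed (use k_lim_int in auto)
  then show ?thesis by eventually_elim simp
qed

lemma integral_k_lim_le: "integral\<^sup>L M k_lim \<le> integral\<^sup>L M f"
proof -
  interpret n: sigma_finite_subalgebra M "F (Suc 0)" by (rule sigma_finite_subalgebra_F)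
  have "integral\<^sup>L M k_lim = integral\<^sup>L M (real_cond_exp M (F (Suc 0)) k_lim)"
    using n.real_cond_exp_int(2)[OF k_lim_int] by simp
  also have "\<dots> = (\<integral>x. lam - gap 0 x \<partial>M)"
    by (rule integral_cong_AE) (use cond_exp_k_lim[of 0] gap_int[of 0] in auto)
  finally show ?thesis using integral_lam_gap_le[of 0] by simp
qed

lemma integral_h_lim: "integral\<^sup>L M h_lim = 0"
proof -
  interpret n: sigma_finite_subalgebra M "F (Suc 0)" by (rule sigma_finite_subalgebra_F)
  have "integral\<^sup>L M h_lim = integral\<^sup>L M (real_cond_exp M (F (Suc 0)) h_lim)"
    using n.real_cond_exp_int(2)[OF h_lim_int] by simp
  also have "\<dots> = (\<integral>x. 0 \<partial>M)"
    by (rule integral_cong_AE) (use cond_exp_h_lim[of 0] in \<open>auto simp: h_def\<close>)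
  finally show ?thesis by simp
qed

lemma integral_abs_h_lim_le: "(\<integral>x. \<bar>h_lim x\<bar> \<partial>M) \<le> 2 * integral\<^sup>L M f"
proof -
  have "(\<integral>x. \<bar>h_lim x\<bar> \<partial>M) \<le> integral\<^sup>L M variation"
  proof (rule integral_mono_AE)
    show "AE x in M. \<bar>h_lim x\<bar> \<le> variation x"
      using AE_summable_incr
      by eventually_elim (auto simp: h_lim_def variation_def intro: summable_rabs)
  qed (use h_lim_int variation_int in auto)
  also have "\<dots> = (\<Sum>i. \<integral>x. \<bar>incr i x\<bar> \<partial>M)"
    unfolding variation_def[abs_def]
    by (rule integral_suminf) (use incr_int AE_summable_incr summable_integral_abs_incr in auto)
  also have "\<dots> \<le> 2 * integral\<^sup>L M f"
    by (rule suminf_le_const[OF summable_integral_abs_incr integral_abs_incr_sum_le])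
  finally show ?thesis .
qed

text \<open>On paths never absorbed the sum is \<open>f x\<close>. On the others
  \<open>k_lim x\<close> is \<open>lam\<close>, while
  \<open>h n x \<ge> - neg n x \<ge> - lam\<close> passes to the limit.\<close>

lemma h_lim_plus_k_lim_nonneg: "AE x in M. 0 \<le> h_lim x + k_lim x"
  using AE_summable_incr AE_regular f_nonneg
proof eventually_elim
  case (elim x)
  have "- lam \<le> h n x" for n
  proof -
    have "- neg n x \<le> h n x"
      unfolding neg_def h_def sum_negf[symmetric] by (rule sum_mono) auto
    then show ?thesis
      using neg_bound[OF elim(2), of n] gap_nonneg[OF elim(2), of n] by linarith
  qed
  then have "- lam \<le> h_lim x"
    by (intro LIMSEQ_le_const[OF h_tendsto[OF elim(1)]]) auto
  with elim show ?case by (auto simp: k_lim_def)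
qed

definition g_lim :: "'a \<Rightarrow> real" where
  "g_lim x = f x - h_lim x - k_lim x"

lemma g_lim_meas: "g_lim \<in> borel_measurable (F_infty M F)"
  unfolding g_lim_def[abs_def] by (intro borel_measurable_diff f_meas h_lim_meas k_lim_meas)

lemma g_lim_int: "integrable M g_lim"
  unfolding g_lim_def[abs_def]
  by (intro Bochner_Integration.integrable_diff f_int h_lim_int k_lim_int)

lemma integral_abs_g_lim_le: "(\<integral>x. \<bar>g_lim x\<bar> \<partial>M) \<le> 2 * integral\<^sup>L M f"
proof -
  have "(\<integral>x. \<bar>g_lim x\<bar> \<partial>M) \<le> (\<integral>x. f x + (h_lim x + k_lim x) \<partial>M)"
  proof (rule integral_mono_AE)
    \<comment> \<open>\<open>g_lim\<close> is the difference of the nonnegative functions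
      \<open>f\<close> and \<open>h_lim + k_lim\<close>.\<close>
    show "AE x in M. \<bar>g_lim x\<bar> \<le> f x + (h_lim x + k_lim x)"
      using h_lim_plus_k_lim_nonneg f_nonneg by eventually_elim (auto simp: g_lim_def)
  qed (use f_int h_lim_int k_lim_int g_lim_int in auto)
  also have "\<dots> = integral\<^sup>L M f + integral\<^sup>L M k_lim"
    using f_int h_lim_int k_lim_int by (simp add: integral_h_lim)
  finally show ?thesis using integral_k_lim_le by linarith
qed

text \<open>On live paths \<open>X n x\<close>, \<open>h n x\<close> and
  \<open>lam - gap n x\<close> cancel by \<open>gap_alive\<close>.\<close>

lemma cond_exp_g_lim:
  "AE x in M. 0 < gap n x \<longrightarrow> real_cond_exp M (F (Suc n)) g_lim x = 0"
proof -
  interpret n: sigma_finite_subalgebra M "F (Suc n)" by (rule sigma_finite_subalgebra_F)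
  have fh: "integrable M (\<lambda>x. f x - h_lim x)" using f_int h_lim_int by auto
  show ?thesis
    unfolding g_lim_def[abs_def]
    using n.real_cond_exp_diff[OF fh k_lim_int] n.real_cond_exp_diff[OF f_int h_lim_int]
      cond_exp_h_lim[of n] cond_exp_k_lim[of n]
    by eventually_elim (use gap_alive in \<open>auto simp: X_def\<close>)
qed

section \<open>The maximal estimate and the variation of conditional expectations\<close>

text \<open>A nonzero conditional expectation of \<open>g_lim\<close> forces absorption, hence
  \<open>k_lim x = lam\<close> up to a null set of paths; Markov's inequality for
  \<open>k_lim\<close> concludes.\<close>

lemma emeasure_sup_g_lim_le:
  "emeasure M {x \<in> space M. (SUP n\<in>{1..}. ennreal \<bar>cond_E M F n g_lim x\<bar>) > 0}
    \<le> ennreal (integral\<^sup>L M f / lam)" (is "emeasure M ?S \<le> _")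
proof -
  have "AE x in M. \<forall>n. 0 < gap n x \<longrightarrow> real_cond_exp M (F (Suc n)) g_lim x = 0"
    using cond_exp_g_lim by (simp add: AE_all_countable)
  then have "AE x in M. x \<in> ?S \<longrightarrow> x \<in> {x \<in> space M. k_lim x \<ge> lam}"
  proof eventually_elim
    case (elim x)
    show ?case
    proof
      assume x: "x \<in> ?S"
      then obtain n where n: "1 \<le> n" "0 < ennreal \<bar>cond_E M F n g_lim x\<bar>"
        by (auto simp: less_SUP_iff)
      then obtain m where "n = Suc m" by (cases n) auto
      with n have "real_cond_exp M (F (Suc m)) g_lim x \<noteq> 0" by (auto simp: cond_E_def)
      with elim have "\<not> 0 < gap m x" by blast
      then show "x \<in> {x \<in> space M. k_lim x \<ge> lam}" using x by (auto simp: k_lim_def)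
    qed
  qed
  then have "emeasure M ?S \<le> emeasure M {x \<in> space M. k_lim x \<ge> lam}"
    by (rule emeasure_mono_AE) measurable
  also have "\<dots> \<le> (1 / lam) * (\<integral>x. k_lim x \<partial>M)"
    by (rule integral_Markov_inequality[OF k_lim_int k_lim_nonneg lam_pos])
  also have "\<dots> \<le> ennreal (integral\<^sup>L M f / lam)"
    using integral_k_lim_le lam_pos by (intro ennreal_leI) (simp add: divide_right_mono)
  finally show ?thesis .
qed

lemma nn_integral_cond_E_variation_le:
  "(\<integral>\<^sup>+x. (\<Sum>n. ennreal \<bar>cond_E M F (Suc n) h_lim x - cond_E M F n h_lim x\<bar>) \<partial>M)
    \<le> ennreal (2 * integral\<^sup>L M f)"
proof -
  let ?D = "\<lambda>n x. cond_E M F (Suc n) h_lim x - cond_E M F n h_lim x"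
  let ?c = "\<lambda>n. \<integral>\<^sup>+x. ennreal \<bar>?D n x\<bar> \<partial>M"
  have [measurable]: "cond_E M F n h_lim \<in> borel_measurable M" for n
    by (simp add: cond_E_def)
  \<comment> \<open>The first difference runs from the zero operator to \<open>h 0 = 0\<close>. All
    later indices are shifted: \<open>cond_E\<close> at \<open>Suc m\<close> yields
    \<open>h m\<close>, so the term \<open>Suc m\<close> is \<open>incr m\<close>.\<close>
  have c0: "?c 0 = 0"
    using cond_exp_h_lim[of 0] by (subst nn_integral_0_iff_AE) (auto simp: cond_E_def h_def)
  have cSuc: "?c (Suc m) = ennreal (\<integral>x. \<bar>incr m x\<bar> \<partial>M)" for m
  proof -
    have "?c (Suc m) = (\<integral>\<^sup>+x. ennreal \<bar>incr m x\<bar> \<partial>M)"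
    proof (rule nn_integral_cong_AE)
      show "AE x in M. ennreal \<bar>?D (Suc m) x\<bar> = ennreal \<bar>incr m x\<bar>"
        using cond_exp_h_lim[of m] cond_exp_h_lim[of "Suc m"]
        by eventually_elim (simp add: cond_E_def h_def)
    qed
    also have "\<dots> = ennreal (\<integral>x. \<bar>incr m x\<bar> \<partial>M)"
      using incr_int by (simp add: nn_integral_eq_integral)
    finally show ?thesis .
  qed
  have "(\<integral>\<^sup>+x. (\<Sum>n. ennreal \<bar>?D n x\<bar>) \<partial>M) = (\<Sum>n. ?c n)"
    by (rule nn_integral_suminf) measurable
  also have "\<dots> \<le> ennreal (2 * integral\<^sup>L M f)"
  proof (rule suminf_le_const)
    fix N
    \<comment> \<open>One term is added so that the vanishing term at 0 can be split off, leaving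
      exactly N corrections.\<close>
    have "sum ?c {..<N} \<le> sum ?c {..<Suc N}" by (rule sum_mono2) auto
    also have "\<dots> = (\<Sum>m<N. ?c (Suc m))" by (simp only: sum.lessThan_Suc_shift c0 add_0)
    also have "\<dots> = ennreal (\<Sum>m<N. \<integral>x. \<bar>incr m x\<bar> \<partial>M)"
      by (simp only: cSuc) (rule sum_ennreal, simp)
    also have "\<dots> \<le> ennreal (2 * integral\<^sup>L M f)"
      by (rule ennreal_leI[OF integral_abs_incr_sum_le])
    finally show "sum ?c {..<N} \<le> ennreal (2 * integral\<^sup>L M f)" .
  qed simp
  finally show ?thesis .
qed

end

section \<open>Translation into norms and conclusion\<close>

lemma Lp_norm_1_integrable: "integrable M u \<Longrightarrow> Lp_norm M 1 u = ennreal (\<integral>x. \<bar>u x\<bar> \<partial>M)"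
  by (simp add: Lp_norm_1 nn_integral_eq_integral)

theorem theorem1p1:
  fixes M :: "'a measure" and F :: "nat \<Rightarrow> 'a measure"
    and f :: "'a \<Rightarrow> real" and lam :: real
  assumes "filtered_complete_prob_space M F"
    and "f \<in> Lp_sub M 1 (F_infty M F)"
    and "AE x in M. 0 \<le> f x"
    and "0 < lam"
  shows "\<exists>g h k.
      g \<in> Lp_sub M 1 (F_infty M F) \<and> h \<in> Lp_sub M 1 (F_infty M F) \<and> k \<in> Lp_sub M 1 (F_infty M F)
    \<and> (AE x in M. f x = g x + h x + k x)
    \<and> (emeasure M {x \<in> space M. (SUP n\<in>{1..}. ennreal \<bar>cond_E M F n g x\<bar>) > 0}
          \<le> Lp_norm M 1 f / ennreal lam
      \<and> Lp_norm M 1 g \<le> 2 * Lp_norm M 1 f)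
    \<and> (Lp_norm_enn M 1 (\<lambda>x. \<Sum>n. ennreal \<bar>cond_E M F (Suc n) h x - cond_E M F n h x\<bar>)
          \<le> 2 * Lp_norm M 1 f
      \<and> Lp_norm M 1 h \<le> 2 * Lp_norm M 1 f)
    \<and> ((AE x in M. 0 \<le> k x \<and> k x \<le> lam)
      \<and> Lp_norm M 1 k \<le> Lp_norm M 1 f
      \<and> (Lp_norm M 2 k)\<^sup>2 \<le> ennreal lam * Lp_norm M 1 f)"
proof -
  interpret filtered_complete_prob_space M F by fact
  note sub = Lp_sub_1_iff[OF subalgebra_F_infty]
  interpret D: gundy_decomposition M F f lam
    by unfold_locales (use assms(2-4) in \<open>auto simp: sub\<close>)
  have I0: "0 \<le> integral\<^sup>L M f" by (rule integral_nonneg_AE) (rule assms(3))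
  have "(\<integral>x. \<bar>f x\<bar> \<partial>M) = integral\<^sup>L M f"
    by (rule integral_cong_AE) (use assms(3) D.f_int in auto)
  then have nf: "Lp_norm M 1 f = ennreal (integral\<^sup>L M f)"
    by (simp add: Lp_norm_1_integrable D.f_int)
  have nf2: "2 * Lp_norm M 1 f = ennreal (2 * integral\<^sup>L M f)"
    using I0 by (simp add: nf ennreal_mult)
  have "(\<integral>x. \<bar>D.k_lim x\<bar> \<partial>M) = integral\<^sup>L M D.k_lim"
    by (rule integral_cong_AE) (use D.k_lim_nonneg in auto)
  then have nk: "Lp_norm M 1 D.k_lim = ennreal (integral\<^sup>L M D.k_lim)"
    by (simp add: Lp_norm_1_integrable D.k_lim_int)
  \<comment> \<open>From 0 \<le> k \<le> \<open>lam\<close> the square of k is at most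
    \<open>lam\<close> times k.\<close>
  have "(Lp_norm M 2 D.k_lim)\<^sup>2 \<le> (\<integral>\<^sup>+x. ennreal (lam * D.k_lim x) \<partial>M)"
    unfolding Lp_norm_2_sq
  proof (rule nn_integral_mono_AE)
    show "AE x in M. ennreal ((D.k_lim x)\<^sup>2) \<le> ennreal (lam * D.k_lim x)"
      using D.k_lim_nonneg D.k_lim_le
      by eventually_elim (auto simp: power2_eq_square intro!: ennreal_leI mult_right_mono)
  qed
  also have "\<dots> = ennreal (\<integral>x. lam * D.k_lim x \<partial>M)"
    using D.k_lim_int D.k_lim_nonneg D.lam_pos
    by (intro nn_integral_eq_integral) auto
  also have "\<dots> \<le> ennreal (lam * integral\<^sup>L M f)"
    using D.integral_k_lim_le D.lam_pos by (intro ennreal_leI) simp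
  also have "\<dots> = ennreal lam * Lp_norm M 1 f"
    using D.lam_pos I0 by (simp add: nf ennreal_mult)
  finally have k2: "(Lp_norm M 2 D.k_lim)\<^sup>2 \<le> ennreal lam * Lp_norm M 1 f" .
  show ?thesis
  proof (intro exI conjI)
    show "D.g_lim \<in> Lp_sub M 1 (F_infty M F)" "D.h_lim \<in> Lp_sub M 1 (F_infty M F)"
      "D.k_lim \<in> Lp_sub M 1 (F_infty M F)"
      by (simp_all add: sub D.g_lim_meas D.g_lim_int D.h_lim_meas D.h_lim_int
          D.k_lim_meas D.k_lim_int)
    show "AE x in M. f x = D.g_lim x + D.h_lim x + D.k_lim x"
      by (simp add: D.g_lim_def)
    show "emeasure M {x \<in> space M. (SUP n\<in>{1..}. ennreal \<bar>cond_E M F n D.g_lim x\<bar>) > 0}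
        \<le> Lp_norm M 1 f / ennreal lam"
      using D.emeasure_sup_g_lim_le I0 D.lam_pos by (simp add: nf divide_ennreal)
    show "Lp_norm M 1 D.g_lim \<le> 2 * Lp_norm M 1 f"
      unfolding nf2 Lp_norm_1_integrable[OF D.g_lim_int]
      by (rule ennreal_leI[OF D.integral_abs_g_lim_le])
    show "Lp_norm_enn M 1 (\<lambda>x. \<Sum>n. ennreal \<bar>cond_E M F (Suc n) D.h_lim x
        - cond_E M F n D.h_lim x\<bar>) \<le> 2 * Lp_norm M 1 f"
      unfolding nf2 Lp_norm_enn_1 by (rule D.nn_integral_cond_E_variation_le)
    show "Lp_norm M 1 D.h_lim \<le> 2 * Lp_norm M 1 f"
      unfolding nf2 Lp_norm_1_integrable[OF D.h_lim_int]
      by (rule ennreal_leI[OF D.integral_abs_h_lim_le])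
    show "AE x in M. 0 \<le> D.k_lim x \<and> D.k_lim x \<le> lam"
      using D.k_lim_nonneg D.k_lim_le by eventually_elim simp
    show "Lp_norm M 1 D.k_lim \<le> Lp_norm M 1 f"
      unfolding nf nk by (rule ennreal_leI[OF D.integral_k_lim_le])
    show "(Lp_norm M 2 D.k_lim)\<^sup>2 \<le> ennreal lam * Lp_norm M 1 f" by (rule k2)
  qed
qed

end
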